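(* For every positive integer $n$ and every $k\in\{0,1,\ldots,n\}$, $$ \binom{n}{k}\leq \frac{2^n}{\sqrt{\pi n/2}} \exp\left(-\frac{2(k-n/2)^2}{n}+\frac{23}{18n}\right). $$ *)

theory Defs imports Complex_Main begin

end

theory Submission imports Defs "HOL-Analysis.Gamma_Function" begin

text \<open>
  By symmetry take \<open>k \<ge> n/2\<close>. With \<open>x = (2k + 1 - n)/(n + 1)\<close> the ratio of consecutive binomial
  coefficients is \<open>(1 - x)/(1 + x) \<le> exp (-2x - 2x\<^sup>3/3)\<close>. Starting at the centre and summing,
  the linear terms give the Gaussian up to an error of order \<open>d\<^sup>2/n\<^sup>2\<close>, where \<open>d = k - n/2\<close>, and
  the cubic terms give a gain of order \<open>d\<^sup>4/n\<^sup>3\<close>. Completing the square in \<open>d\<^sup>2\<close> bounds the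
  difference by a multiple of \<open>1/n\<close>. The central coefficient is estimated by Wallis' product.
\<close>

section \<open>Ratio of consecutive binomial coefficients\<close>

text \<open>The left side consists of the first two terms of the series of 2 artanh x. Both sides
  vanish at 0, and the difference has derivative 2 t^4 / (1 - t^2), which is nonnegative.\<close>

lemma ln_ratio_ge_cubic:
  fixes x :: real
  assumes "0 \<le> x" "x < 1"
  shows "2 * x + 2 * x ^ 3 / 3 \<le> ln ((1 + x) / (1 - x))"
proof -
  define f where "f = (\<lambda>t::real. ln (1 + t) - ln (1 - t) - 2 * t - (2 / 3) * t ^ 3)"
  have "f 0 \<le> f x"
  proof (rule DERIV_nonneg_imp_nondecreasing[OF assms(1)])
    fix t :: real assume t: "0 \<le> t" "t \<le> x"
    with assms have t1: "t < 1" by simp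
    have "(f has_real_derivative (1 / (1 + t) + 1 / (1 - t) - 2 - 2 * t\<^sup>2)) (at t)"
      unfolding f_def using t t1
      by (auto intro!: derivative_eq_intros)
    moreover have "1 / (1 + t) + 1 / (1 - t) - 2 - 2 * t\<^sup>2 = 2 * t ^ 4 / ((1 + t) * (1 - t))"
    proof -
      have "1 + t \<noteq> 0" "1 - t \<noteq> 0" using t t1 by linarith+
      then show ?thesis
        by (simp add: divide_simps) (simp add: algebra_simps power2_eq_square power4_eq_xxxx)
    qed
    ultimately show "\<exists>y. (f has_real_derivative y) (at t) \<and> 0 \<le> y"
      using t t1 by auto
  qed
  then show ?thesis
    using assms by (simp add: f_def ln_div)
qed

lemma ratio_le_exp_cubic:
  fixes x :: real
  assumes "0 \<le> x" "x < 1"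
  shows "(1 - x) / (1 + x) \<le> exp (- 2 * x - 2 * x ^ 3 / 3)"
proof -
  have "exp (2 * x + 2 * x ^ 3 / 3) \<le> exp (ln ((1 + x) / (1 - x)))"
    using ln_ratio_ge_cubic[OF assms] by simp
  also have "\<dots> = (1 + x) / (1 - x)"
    using assms by simp
  finally have "inverse ((1 + x) / (1 - x)) \<le> inverse (exp (2 * x + 2 * x ^ 3 / 3))"
    by (intro le_imp_inverse_le) auto
  then show ?thesis
    by (simp flip: exp_minus)
qed

text \<open>The exact ratio is (n - k) / (k + 1), and \<open>x\<close> is the number for which this
  equals (1 - x) / (1 + x). The two hypotheses on \<open>k\<close> say precisely that 0 \<le> x <
  1.\<close>

lemma binomial_Suc_le_exp:
  fixes n k :: nat and x :: real
  assumes "k < n" "n \<le> 2 * k + 1"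
    and x: "x = (2 * real k + 1 - real n) / (real n + 1)"
  shows "real (n choose Suc k) \<le> real (n choose k) * exp (- 2 * x - 2 * x ^ 3 / 3)"
proof -
  have "Suc k * (n choose Suc k) = (n - k) * (n choose k)"
    using binomial_absorb_comp[of n k] binomial_absorption[of k n] by simp
  then have "real (Suc k) * real (n choose Suc k) = (real n - real k) * real (n choose k)"
    using assms(1) by (metis of_nat_mult of_nat_diff less_imp_le)
  then have "real (n choose Suc k) = real (n choose k) * ((real n - real k) / (real k + 1))"
    by (simp add: field_simps)
  also have "(real n - real k) / (real k + 1) = (1 - x) / (1 + x)"
  proof -
    have "1 - x = 2 * (real n - real k) / (real n + 1)" "1 + x = 2 * (real k + 1) / (real n + 1)"
      by (simp_all add: x field_simps)
    then show ?thesis by (simp del: distrib_left_numeral right_diff_distrib_numeral)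
  qed
  also have "\<dots> \<le> exp (- 2 * x - 2 * x ^ 3 / 3)"
  proof (rule ratio_le_exp_cubic)
    show "0 \<le> x" using assms(2) unfolding x by (intro divide_nonneg_pos) auto
    show "x < 1" using assms(1) unfolding x by (simp add: divide_less_eq)
  qed
  finally show ?thesis
    by (simp add: mult_left_mono)
qed

section \<open>Descent from the centre of the row\<close>

text \<open>The step from m + i to m + i + 1 has x = (2i + 1) / N. The exponent is the exact sum of
  these steps over i < j: the odd numbers 2i + 1 add up to j^2 and their cubes to 2 j^4 -
  j^2.\<close>

lemma even_binomial_le_central:
  fixes m j :: nat
  assumes "j \<le> m"
  defines "N \<equiv> 2 * real m + 1"
  shows "real (2 * m choose (m + j)) \<le> real (2 * m choose m) *
    exp (- 2 * (real j)\<^sup>2 / N - 2 * (2 * real j ^ 4 - (real j)\<^sup>2) / (3 * N ^ 3))"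
  using assms(1)
proof (induction j)
  case 0
  then show ?case by simp
next
  case (Suc j)
  have N: "N > 0" by (simp add: N_def)
  let ?x = "(2 * real j + 1) / N"
  let ?E = "\<lambda>j. - 2 * (real j)\<^sup>2 / N - 2 * (2 * real j ^ 4 - (real j)\<^sup>2) / (3 * N ^ 3)"
  have "real (2 * m choose (m + Suc j)) \<le>
      real (2 * m choose (m + j)) * exp (- 2 * ?x - 2 * ?x ^ 3 / 3)"
    using binomial_Suc_le_exp[of "m + j" "2 * m" ?x] Suc.prems by (simp add: N_def)
  also have "\<dots> \<le> real (2 * m choose m) * exp (?E j) * exp (- 2 * ?x - 2 * ?x ^ 3 / 3)"
    using Suc by (intro mult_right_mono) auto
  also have "\<dots> = real (2 * m choose m) * exp (?E j + (- 2 * ?x - 2 * ?x ^ 3 / 3))"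
    by (simp only: exp_add mult.assoc)
  also have "?E j + (- 2 * ?x - 2 * ?x ^ 3 / 3) = ?E (Suc j)"
    using N by (simp add: field_simps) algebra
  finally show ?case .
qed

text \<open>Here the steps have x = (i + 1) / M. Twice the sum of i + 1 over i < j is
  \<open>v j\<close>, and the sum of the cubes is (v j)^2 / 4, so \<open>v j\<close> is the natural
  variable in odd rows.\<close>

lemma odd_binomial_le_central:
  fixes m j :: nat
  assumes "j \<le> m"
  defines "M \<equiv> real m + 1" and "v \<equiv> \<lambda>j. real j * (real j + 1)"
  shows "real (2 * m + 1 choose (m + 1 + j)) \<le> real (2 * m + 1 choose (m + 1)) *
    exp (- v j / M - (v j)\<^sup>2 / (6 * M ^ 3))"
  using assms(1)
proof (induction j)
  case 0
  then show ?case by (simp add: v_def)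
next
  case (Suc j)
  have M: "M > 0" by (simp add: M_def)
  let ?x = "(real j + 1) / M"
  let ?E = "\<lambda>j. - v j / M - (v j)\<^sup>2 / (6 * M ^ 3)"
  have x: "?x = (2 * real (m + 1 + j) + 1 - real (2 * m + 1)) / (real (2 * m + 1) + 1)"
    by (simp add: M_def field_simps)
  have "real (2 * m + 1 choose Suc (m + 1 + j)) \<le>
      real (2 * m + 1 choose (m + 1 + j)) * exp (- 2 * ?x - 2 * ?x ^ 3 / 3)"
    using Suc.prems by (intro binomial_Suc_le_exp x) auto
  also have "\<dots> \<le> real (2 * m + 1 choose (m + 1)) * exp (?E j) * exp (- 2 * ?x - 2 * ?x ^ 3 / 3)"
    using Suc by (intro mult_right_mono) auto
  also have "\<dots> = real (2 * m + 1 choose (m + 1)) * exp (?E j + (- 2 * ?x - 2 * ?x ^ 3 / 3))"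
    by (simp only: exp_add mult.assoc)
  also have "?E j + (- 2 * ?x - 2 * ?x ^ 3 / 3) = ?E (Suc j)"
    using M by (simp add: v_def field_simps) algebra
  finally show ?case by simp
qed

section \<open>Central coefficient and the Wallis product\<close>

text \<open>Absorption is applied in rows 2m + 2 and 2m + 1; in between, the symmetry of row 2m + 1
  exchanges the indices m and m + 1.\<close>

lemma central_binomial_Suc:
  "(real m + 1) * real (2 * Suc m choose Suc m) = 2 * (2 * real m + 1) * real (2 * m choose m)"
proof -
  have "Suc m * (Suc (Suc (2 * m)) choose Suc m) = Suc (Suc (2 * m)) * (Suc (2 * m) choose m)"
    by (rule Suc_times_binomial)
  moreover have "Suc (2 * m) choose m = Suc (2 * m) choose Suc m"
    using binomial_symmetric[of m "Suc (2 * m)"] by (simp add: Suc_diff_le)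
  moreover have "Suc m * (Suc (2 * m) choose Suc m) = Suc (2 * m) * (2 * m choose m)"
    by (rule Suc_times_binomial)
  moreover have "2 * Suc m = Suc (Suc (2 * m))" by simp
  ultimately have "Suc m * (2 * Suc m choose Suc m) = 2 * (Suc (2 * m) * (2 * m choose m))"
    by (metis mult.assoc)
  then have "real (Suc m * (2 * Suc m choose Suc m)) = real (2 * (Suc (2 * m) * (2 * m choose m)))"
    by (rule arg_cong)
  moreover have "real (Suc m) = real m + 1" "real (Suc (2 * m)) = 2 * real m + 1" by simp_all
  ultimately show ?thesis
    by (simp only: of_nat_mult of_nat_numeral mult.assoc)
qed

text \<open>Passing from m to m + 1 multiplies 4^m / (2m choose m) by 2(m + 1) / (2m + 1), and the
  left side by the square of that factor.\<close>

lemma wallis_partial_product_central_binomial: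
  "(\<Prod>k=1..m. 4 * real k ^ 2 / (4 * real k ^ 2 - 1)) * (2 * real m + 1) =
    (4 ^ m / real (2 * m choose m))\<^sup>2"
proof (induction m)
  case 0
  then show ?case by simp
next
  case (Suc m)
  let ?P = "\<Prod>k=1..m. 4 * real k ^ 2 / (4 * real k ^ 2 - 1)"
  have C: "real (2 * Suc m choose Suc m) =
      2 * (2 * real m + 1) * real (2 * m choose m) / (real m + 1)"
    using central_binomial_Suc[of m] by (simp add: field_simps)
  have d: "4 * real (Suc m) ^ 2 - 1 = (2 * real m + 1) * (2 * real m + 3)"
    by (simp add: algebra_simps power2_eq_square)
  have "(\<Prod>k=1..Suc m. 4 * real k ^ 2 / (4 * real k ^ 2 - 1)) * (2 * real (Suc m) + 1) =
      ?P * (4 * real (Suc m) ^ 2 / ((2 * real m + 1) * (2 * real m + 3))) * (2 * real m + 3)"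
  proof -
    have "2 * real (Suc m) + 1 = 2 * real m + 3" by simp
    then show ?thesis by (simp only: prod.cl_ivl_Suc d) simp
  qed
  also have "\<dots> = ?P * (2 * real m + 1) * (2 * (real m + 1) / (2 * real m + 1))\<^sup>2"
  proof -
    have "2 * real m + 1 \<noteq> 0" "2 * real m + 3 \<noteq> 0" by linarith+
    then show ?thesis by (simp add: divide_simps power2_eq_square) (simp add: algebra_simps)
  qed
  also have "\<dots> = (4 ^ m / real (2 * m choose m) * (2 * (real m + 1) / (2 * real m + 1)))\<^sup>2"
    by (simp only: Suc.IH power_mult_distrib)
  also have "4 ^ m / real (2 * m choose m) * (2 * (real m + 1) / (2 * real m + 1)) =
      4 ^ Suc m / real (2 * Suc m choose Suc m)"
    by (subst C) (simp add: divide_simps, simp add: algebra_simps)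
  finally show ?case .
qed

text \<open>Multiplying the Wallis products by 1 + 1/(2m) keeps the limit pi/2 but makes the
  sequence decreasing, so every term is at least pi/2. By the closed form the m-th term is (4^m /
  (2m choose m))^2 / (2m).\<close>

lemma central_binomial_le:
  assumes "m \<ge> 1"
  shows "real (2 * m choose m) \<le> 4 ^ m / sqrt (pi * real m)"
proof -
  define P where "P = (\<lambda>m. \<Prod>k=1..m. 4 * real k ^ 2 / (4 * real k ^ 2 - 1))"
  \<comment> \<open>The shift to \<open>Suc m\<close> excludes the index 0, where 1/0 = 0 would give
    the term 1, below the limit, and destroy monotonicity.\<close>
  define Q where "Q = (\<lambda>m. P (Suc m) * (1 + 1 / (2 * real (Suc m))))"
  have Ppos: "P m > 0" for m
    unfolding P_def
  proof (intro prod_pos ballI)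
    fix k assume "k \<in> {1..m}"
    then have "1 \<le> real k ^ 2" by simp
    then show "0 < 4 * real k ^ 2 / (4 * real k ^ 2 - 1)" by (intro divide_pos_pos) linarith+
  qed
  have "(\<lambda>m. P (Suc m) * (1 + 1 / (2 * real (Suc m)))) \<longlonglongrightarrow> (pi / 2) * (1 + 0)"
  proof (intro tendsto_mult tendsto_add tendsto_const)
    show "(\<lambda>m. P (Suc m)) \<longlonglongrightarrow> pi / 2"
      using wallis unfolding P_def by (rule LIMSEQ_Suc)
    show "(\<lambda>m. 1 / (2 * real (Suc m))) \<longlonglongrightarrow> 0"
      using tendsto_mult_right[OF LIMSEQ_inverse_real_of_nat, of "1/2"] by (simp add: field_simps)
  qed
  then have lim: "Q \<longlonglongrightarrow> pi / 2" by (simp add: Q_def)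
  have "decseq Q"
  proof (rule decseq_SucI)
    fix i
    define t where "t = real i + 1"
    have t: "t > 0" by (simp add: t_def)
    have d: "4 * (t + 1) ^ 2 - 1 = (2 * t + 1) * (2 * t + 3)"
      by (simp add: algebra_simps power2_eq_square)
    have "Q (Suc i) = P (Suc i) * (4 * (t + 1) ^ 2 / (4 * (t + 1) ^ 2 - 1) * (1 + 1 / (2 * (t + 1))))"
      by (simp add: Q_def P_def t_def add.commute)
    also have "\<dots> = P (Suc i) * (2 * (t + 1) / (2 * t + 1))"
    proof -
      have "4 * (t + 1) ^ 2 / ((2 * t + 1) * (2 * t + 3)) * (1 + 1 / (2 * (t + 1))) =
          2 * (t + 1) / (2 * t + 1)"
        using t by (simp add: divide_simps power2_eq_square) (simp add: algebra_simps)
      then show ?thesis by (simp add: d)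
    qed
    \<comment> \<open>Cross-multiplied, this is 4t(t + 1) \<le> (2t + 1)^2.\<close>
    also have "\<dots> \<le> P (Suc i) * (1 + 1 / (2 * t))"
      using Ppos[of "Suc i"] t by (intro mult_left_mono) (auto simp: field_simps)
    also have "\<dots> = Q i" by (simp add: Q_def t_def add.commute)
    finally show "Q (Suc i) \<le> Q i" .
  qed
  then have "pi / 2 \<le> Q (m - 1)"
    using lim by (rule decseq_ge)
  also have "Q (m - 1) = P m * (2 * real m + 1) / (2 * real m)"
    using assms by (simp add: Q_def field_simps)
  also have "P m * (2 * real m + 1) = (4 ^ m / real (2 * m choose m))\<^sup>2"
    unfolding P_def by (rule wallis_partial_product_central_binomial)
  finally have "pi * real m \<le> (4 ^ m / real (2 * m choose m))\<^sup>2"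
    using assms by (simp add: field_simps)
  then have "sqrt (pi * real m) \<le> 4 ^ m / real (2 * m choose m)"
    by (intro real_le_lsqrt) auto
  moreover have "real (2 * m choose m) > 0" "sqrt (pi * real m) > 0"
    using assms by auto
  ultimately show ?thesis
    by (simp add: field_simps)
qed

section \<open>Comparison of the exponents\<close>

text \<open>Used with \<open>u\<close> a squared distance from the centre: a u is the loss in the
  Gaussian term, b u^2 the gain from the cubic term, and the bound is uniform in
  \<open>u\<close>.\<close>

lemma quadratic_le_vertex:
  fixes a b u :: real
  assumes "b > 0"
  shows "a * u - b * u\<^sup>2 \<le> a\<^sup>2 / (4 * b)"
proof -
  have "a\<^sup>2 / (4 * b) - (a * u - b * u\<^sup>2) = (a - 2 * b * u)\<^sup>2 / (4 * b)"
    using assms by (simp add: field_simps power2_eq_square)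
  also have "\<dots> \<ge> 0" using assms by simp
  finally show ?thesis by simp
qed

lemma even_exponent_le:
  fixes m j :: nat
  assumes "m \<ge> 1" "j \<le> m"
  defines "N \<equiv> 2 * real m + 1"
  shows "- 2 * (real j)\<^sup>2 / N - 2 * (2 * real j ^ 4 - (real j)\<^sup>2) / (3 * N ^ 3) \<le>
    - (real j)\<^sup>2 / real m + 23 / (36 * real m)"
\<comment> \<open>For m = 1 the vertex bound slightly exceeds 23/36 N^3, so the two values of
  \<open>j\<close> are checked directly.\<close>
proof (cases "m = 1")
  case True
  then have "j = 0 \<or> j = 1" using assms by auto
  then show ?thesis by (auto simp: N_def True)
next
  case False
  define t where "t = real m - 2"
  have t: "t \<ge> 0" "real m = t + 2" "real m > 0"
    using False assms(1) by (auto simp: t_def)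
  have N: "N = 2 * t + 5" "N > 0" using t by (auto simp: N_def)
  define u where "u = (real j)\<^sup>2"
  have u4: "real j ^ 4 = u\<^sup>2" by (simp add: u_def flip: power_mult)
  have "(N\<^sup>2 + 2 * real m / 3) * u - (4 * real m / 3) * u\<^sup>2 \<le>
      (N\<^sup>2 + 2 * real m / 3)\<^sup>2 / (4 * (4 * real m / 3))"
    using t by (intro quadratic_le_vertex) auto
  also have "\<dots> \<le> 23 / 36 * N ^ 3"
  proof -
    \<comment> \<open>This is 144 m times the difference of the two sides. As a polynomial in t = m
      - 2 it has only positive coefficients.\<close>
    have "92 * (t + 2) * (2 * t + 5) ^ 3 - 27 * ((2 * t + 5)\<^sup>2 + 2 * (t + 2) / 3)\<^sup>2 \<ge> 0"
      using t(1) by (simp add: power2_eq_square power3_eq_cube algebra_simps)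
    then show ?thesis using t(3) unfolding t(2) N(1)
      by (simp add: field_simps)
  qed
  finally have *: "(N\<^sup>2 + 2 * real m / 3) * u - (4 * real m / 3) * u\<^sup>2 \<le> 23 / 36 * N ^ 3" .
  have "- u / real m + 23 / (36 * real m) - (- 2 * u / N - 2 * (2 * u\<^sup>2 - u) / (3 * N ^ 3)) =
     (23 / 36 * N ^ 3 - (N * N\<^sup>2 - 2 * real m * N\<^sup>2 + 2 * real m / 3) * u + (4 * real m / 3) * u\<^sup>2)
       / (real m * N ^ 3)"
    using t(3) N(2) by (simp add: field_simps power2_eq_square power3_eq_cube)
  \<comment> \<open>Since N - 2m = 1, the terms of order N^3 cancel: the Gaussian exponents u/m and
    2u/N differ only by u / (m N).\<close>
  also have "N * N\<^sup>2 - 2 * real m * N\<^sup>2 = N\<^sup>2"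
    by (simp add: N_def algebra_simps)
  also have "(23 / 36 * N ^ 3 - (N\<^sup>2 + 2 * real m / 3) * u + (4 * real m / 3) * u\<^sup>2)
       / (real m * N ^ 3) \<ge> 0"
    using * t(3) N(2) by (intro divide_nonneg_pos) auto
  finally show ?thesis by (simp add: u4 flip: u_def)
qed

text \<open>The leading term -1 / (2(n + 1)) is the saving from the central coefficient of an odd
  row. As 2M - n = 1, the loss is v / (n M), and its excess over the quartic gain is at most 3M / (2
  n^2).\<close>

lemma odd_exponent_le:
  fixes m j :: nat
  assumes "j \<le> m"
  defines "M \<equiv> real m + 1" and "n \<equiv> 2 * real m + 1" and "v \<equiv> real j * (real j + 1)"
  shows "- 1 / (2 * (n + 1)) + (- v / M - v\<^sup>2 / (6 * M ^ 3)) \<le>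
    - (2 * (real j + 1 / 2)\<^sup>2 / n) + 23 / (18 * n)"
\<comment> \<open>The final estimate after the vertex bound fails for n = 1; from m = 1 on, the
  numerator is a polynomial in t = m - 1 with positive coefficients.\<close>
proof (cases "m = 0")
  case True
  then show ?thesis using assms by (simp add: power2_eq_square)
next
  case False
  define t where "t = real m - 1"
  have t: "t \<ge> 0" "real m = t + 1" using False by (auto simp: t_def)
  have pos: "M > 0" "n > 0" by (auto simp: M_def n_def)
  have nM: "n = 2 * M - 1" by (simp add: M_def n_def)
  have d: "2 * (real j + 1 / 2)\<^sup>2 = 2 * v + 1 / 2"
    by (simp add: v_def power2_eq_square algebra_simps)
  have "1 / (n * M) * v - 1 / (6 * M ^ 3) * v\<^sup>2 \<le> (1 / (n * M))\<^sup>2 / (4 * (1 / (6 * M ^ 3)))"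
    using pos by (intro quadratic_le_vertex) auto
  also have "\<dots> = 3 * M / (2 * n\<^sup>2)"
    using pos by (simp add: field_simps power2_eq_square power3_eq_cube)
  finally have *: "1 / (n * M) * v - 1 / (6 * M ^ 3) * v\<^sup>2 \<le> 3 * M / (2 * n\<^sup>2)" .
  have "2 * v / n - v / M = 1 / (n * M) * v"
    using pos unfolding nM by (simp add: divide_simps) (simp add: algebra_simps)
  moreover have "3 * M / (2 * n\<^sup>2) + 1 / (2 * n) - 1 / (2 * (n + 1)) \<le> 23 / (18 * n)"
  proof -
    have e: "M = t + 2" "n = 2 * t + 3" "n + 1 = 2 * t + 4"
      using t by (auto simp: M_def n_def)
    have "23 / (18 * n) - (3 * M / (2 * n\<^sup>2) + 1 / (2 * n) - 1 / (2 * (n + 1))) =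
        (23 * n * (n + 1) - 27 * M * (n + 1) - 9 * n * (n + 1) + 9 * n\<^sup>2) / (18 * n\<^sup>2 * (n + 1))"
      using pos by (simp add: divide_simps power2_eq_square) (simp add: algebra_simps)
    also have "\<dots> \<ge> 0"
    proof (rule divide_nonneg_pos)
      show "0 \<le> 23 * n * (n + 1) - 27 * M * (n + 1) - 9 * n * (n + 1) + 9 * n\<^sup>2"
        unfolding e using t(1) by (simp add: algebra_simps power2_eq_square)
    qed (use pos in auto)
    finally show ?thesis by simp
  qed
  ultimately show ?thesis
    using * by (simp add: d add_divide_distrib)
qed

section \<open>Central coefficient of odd rows\<close>

text \<open>The coefficient is half the central one of row n + 1, which puts n + 1 in place of n
  under the root. The correction sqrt (n / (n + 1)) is bounded through 1 - y \<le> exp (-y) with y =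
  1 / (n + 1).\<close>

lemma odd_central_binomial_le:
  fixes m :: nat
  defines "n \<equiv> 2 * real m + 1"
  shows "real (2 * m + 1 choose (m + 1)) \<le>
    2 ^ (2 * m + 1) / sqrt (pi * n / 2) * exp (- 1 / (2 * (n + 1)))"
proof -
  have n: "n > 0" by (simp add: n_def)
  have "Suc (2 * m) choose m = Suc (2 * m) choose Suc m"
    using binomial_symmetric[of m "Suc (2 * m)"] by (simp add: Suc_diff_le)
  then have "2 * real (2 * m + 1 choose (m + 1)) = real (2 * Suc m choose Suc m)"
    by simp
  also have "\<dots> \<le> 4 ^ Suc m / sqrt (pi * real (Suc m))"
    by (rule central_binomial_le) simp
  also have "4 ^ Suc m = (2 * 2 ^ (2 * m + 1) :: real)"
    by (simp add: power_mult)
  also have "pi * real (Suc m) = pi * (n + 1) / 2" by (simp add: n_def field_simps)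
  finally have le: "real (2 * m + 1 choose (m + 1)) \<le> 2 ^ (2 * m + 1) / sqrt (pi * (n + 1) / 2)"
    by simp
  have "n / (n + 1) = 1 + (- 1 / (n + 1))" using n by (simp add: field_simps)
  also have "\<dots> \<le> exp (- 1 / (n + 1))" by (rule exp_ge_add_one_self)
  also have "- 1 / (n + 1) = - 1 / (2 * (n + 1)) + - 1 / (2 * (n + 1))"
    using n by (simp add: divide_simps)
  also have "exp \<dots> = (exp (- 1 / (2 * (n + 1))))\<^sup>2"
    by (simp only: exp_add power2_eq_square)
  finally have "sqrt (n / (n + 1)) \<le> exp (- 1 / (2 * (n + 1)))"
    by (intro real_le_lsqrt) auto
  then have "2 ^ (2 * m + 1) / sqrt (pi * n / 2) * sqrt (n / (n + 1)) \<le>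
      2 ^ (2 * m + 1) / sqrt (pi * n / 2) * exp (- 1 / (2 * (n + 1)))"
    using n by (intro mult_left_mono) auto
  moreover have "2 ^ (2 * m + 1) / sqrt (pi * n / 2) * sqrt (n / (n + 1)) =
      2 ^ (2 * m + 1) / sqrt (pi * (n + 1) / 2)"
    using n by (simp add: real_sqrt_mult real_sqrt_divide)
  ultimately show ?thesis using le by linarith
qed

section \<open>Gaussian bound on the upper half, then on the whole row by reflection\<close>

text \<open>The distance k - n/2 is an integer \<open>j\<close> in even rows and j + 1/2 in odd
  rows, so the two parities combine different central coefficients and exponents.\<close>

lemma binomial_le_gaussian_upper_half:
  fixes n k :: nat
  assumes "n \<ge> 1" "k \<le> n" "n \<le> 2 * k"
  shows "real (n choose k) \<le>
    2 ^ n / sqrt (pi * real n / 2) *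
      exp (- (2 * (real k - real n / 2)\<^sup>2 / real n) + 23 / (18 * real n))"
proof (cases "even n")
  case True
  then obtain m where n: "n = 2 * m" by blast
  define j where "j = k - m"
  have k: "k = m + j" and m: "m \<ge> 1" and j: "j \<le> m"
    using assms n by (auto simp: j_def)
  let ?N = "2 * real m + 1"
  let ?E = "- 2 * (real j)\<^sup>2 / ?N - 2 * (2 * real j ^ 4 - (real j)\<^sup>2) / (3 * ?N ^ 3)"
  have "real (n choose k) \<le> real (2 * m choose m) * exp ?E"
    unfolding n k by (rule even_binomial_le_central[OF j])
  also have "\<dots> \<le> 4 ^ m / sqrt (pi * real m) * exp (- (real j)\<^sup>2 / real m + 23 / (36 * real m))"
    using even_exponent_le[OF m j] by (intro mult_mono central_binomial_le m) auto
  also have "\<dots> = 2 ^ n / sqrt (pi * real n / 2) *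
      exp (- (2 * (real k - real n / 2)\<^sup>2 / real n) + 23 / (18 * real n))"
    by (simp add: n k power_mult)
  finally show ?thesis .
next
  case False
  then obtain m where n: "n = 2 * m + 1" by (auto elim: oddE)
  define j where "j = k - (m + 1)"
  have k: "k = m + 1 + j" and j: "j \<le> m"
    using assms n by (auto simp: j_def)
  let ?n = "2 * real m + 1"
  let ?M = "real m + 1"
  let ?v = "real j * (real j + 1)"
  let ?E = "- ?v / ?M - ?v\<^sup>2 / (6 * ?M ^ 3)"
  have "real (n choose k) \<le> real (2 * m + 1 choose (m + 1)) * exp ?E"
    unfolding n k by (rule odd_binomial_le_central[OF j])
  also have "\<dots> \<le> 2 ^ (2 * m + 1) / sqrt (pi * ?n / 2) * exp (- 1 / (2 * (?n + 1))) * exp ?E"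
    by (intro mult_right_mono odd_central_binomial_le) auto
  also have "\<dots> = 2 ^ (2 * m + 1) / sqrt (pi * ?n / 2) * exp (- 1 / (2 * (?n + 1)) + ?E)"
    by (simp only: exp_add mult.assoc)
  also have "\<dots> \<le> 2 ^ (2 * m + 1) / sqrt (pi * ?n / 2) *
      exp (- (2 * (real j + 1 / 2)\<^sup>2 / ?n) + 23 / (18 * ?n))"
    using odd_exponent_le[OF j] by (intro mult_left_mono) auto
  also have "real j + 1 / 2 = real k - real n / 2"
    by (simp add: n k field_simps)
  also have "?n = real n" by (simp add: n)
  finally show ?thesis by (simp only: n)
qed

theorem mainTheorem1:
  fixes n k :: nat
  assumes "n \<ge> 1" and "k \<le> n"
  shows "real (n choose k) \<le>
    2 ^ n / sqrt (pi * real n / 2) *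
      exp (- (2 * (real k - real n / 2)\<^sup>2 / real n) + 23 / (18 * real n))"
proof (cases "n \<le> 2 * k")
  case True
  then show ?thesis using assms by (intro binomial_le_gaussian_upper_half)
next
  case False
  have "(real (n - k) - real n / 2)\<^sup>2 = (real k - real n / 2)\<^sup>2"
    using assms(2) by (simp add: of_nat_diff power2_eq_square algebra_simps)
  moreover have "n choose (n - k) = n choose k"
    using binomial_symmetric[OF assms(2)] by simp
  ultimately show ?thesis
    using binomial_le_gaussian_upper_half[of n "n - k"] assms False by simp
qed

end
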